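(* Let $\Omega\subset\mathbb{R}^n$ be a bounded domain and let $(u,v)$ solve $$u_t=d_1\Delta u+a_1u-b_1u^2-c_1uv,\qquad v_t=d_2\Delta v+\frac{a_2v}{1+k(x)u}-b_2v^2-c_2uv\quad\text{in }\Omega\times(0,\infty),$$ with $\partial_\nu u=\partial_\nu v=0$ on $\partial\Omega$ and constant initial data $u(x,0)\equiv c>0$, $v(x,0)\equiv d>0$, where $k$ satisfies the standing assumptions below. If $$\frac{a_1}{a_2}>\max\left\{\frac{b_1}{c_2},\frac{c_1}{b_2}\right\},$$ then $(u,v)$ converges uniformly on $\Omega$ to $(\frac{a_1}{b_1},0)$ as $t\to\infty$.
   Context: Standing assumptions on $k$: $k\in C^1(\overline\Omega)$, $k\ge0$, and $k$ vanishes only on a set of Lebesgue measure zero. All parameters $a_i,b_i,c_i,d_i$ are positive. *)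

theory Defs
  imports "HOL-Analysis.Analysis"
begin

definition pdiff :: "(real^'n \<Rightarrow> real) \<Rightarrow> 'n \<Rightarrow> real^'n \<Rightarrow> real" where
  "pdiff f i x = deriv (\<lambda>s. f (x + s *\<^sub>R axis i 1)) 0"

definition laplacian :: "(real^'n \<Rightarrow> real) \<Rightarrow> real^'n \<Rightarrow> real" where
  "laplacian f x = (\<Sum>i\<in>UNIV. pdiff (pdiff f i) i x)"

definition C2_on :: "(real^'n) set \<Rightarrow> (real^'n \<Rightarrow> real) \<Rightarrow> bool" where
  "C2_on U f \<longleftrightarrow> continuous_on U f \<and>
     (\<forall>i. (\<forall>x\<in>U. (\<lambda>s. f (x + s *\<^sub>R axis i 1)) differentiable (at 0)) \<and> continuous_on U (pdiff f i) \<and>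
          (\<forall>j. (\<forall>x\<in>U. (\<lambda>s. pdiff f i (x + s *\<^sub>R axis j 1)) differentiable (at 0))
               \<and> continuous_on U (pdiff (pdiff f i) j)))"

definition C1_closure :: "(real^'n) set \<Rightarrow> (real^'n \<Rightarrow> real) \<Rightarrow> bool" where
  "C1_closure U k \<longleftrightarrow> continuous_on (closure U) k \<and>
     (\<forall>i. \<exists>g. continuous_on (closure U) g \<and>
          (\<forall>x\<in>U. ((\<lambda>s. k (x + s *\<^sub>R axis i 1)) has_real_derivative g x) (at 0)))"

text \<open>\<nu> is a continuous outward unit normal field of the (differentiable) boundary of U:
  near a boundary point x, points strictly inside the cone (y-x)\<bullet>\<nu> x < -\<epsilon>|y-x|
  lie in U and points with (y-x)\<bullet>\<nu> x > \<epsilon>|y-x| lie outside the closure of U.\<close>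
definition outward_unit_normal :: "(real^'n) set \<Rightarrow> (real^'n \<Rightarrow> real^'n) \<Rightarrow> bool" where
  "outward_unit_normal U \<nu> \<longleftrightarrow> continuous_on (frontier U) \<nu> \<and>
     (\<forall>x\<in>frontier U. norm (\<nu> x) = 1 \<and>
        (\<forall>\<epsilon>>0. \<exists>\<delta>>0. \<forall>y\<in>ball x \<delta>.
            ((y - x) \<bullet> \<nu> x < - \<epsilon> * norm (y - x) \<longrightarrow> y \<in> U) \<and>
            ((y - x) \<bullet> \<nu> x > \<epsilon> * norm (y - x) \<longrightarrow> y \<notin> closure U)))"

definition classical_solution ::
  "(real^'n) set \<Rightarrow> (real^'n \<Rightarrow> real^'n) \<Rightarrow> (real^'n \<Rightarrow> real) \<Rightarrow>
   real \<Rightarrow> real \<Rightarrow> real \<Rightarrow> real \<Rightarrow> real \<Rightarrow> real \<Rightarrow> real \<Rightarrow> real \<Rightarrow> real \<Rightarrow> real \<Rightarrow>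
   (real^'n \<Rightarrow> real \<Rightarrow> real) \<Rightarrow> (real^'n \<Rightarrow> real \<Rightarrow> real) \<Rightarrow> bool" where
  "classical_solution \<Omega> \<nu> k d1 d2 a1 a2 b1 b2 c1 c2 c d u v \<longleftrightarrow>
     continuous_on (closure \<Omega> \<times> {0..}) (\<lambda>(x,t). u x t) \<and>
     continuous_on (closure \<Omega> \<times> {0..}) (\<lambda>(x,t). v x t) \<and>
     (\<forall>t>0. C2_on \<Omega> (\<lambda>x. u x t) \<and> C2_on \<Omega> (\<lambda>x. v x t)) \<and>
     (\<forall>x\<in>\<Omega>. \<forall>t>0.
        ((\<lambda>s. u x s) has_real_derivative
            (d1 * laplacian (\<lambda>y. u y t) x + a1 * u x t - b1 * (u x t)\<^sup>2 - c1 * u x t * v x t)) (at t) \<and>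
        ((\<lambda>s. v x s) has_real_derivative
            (d2 * laplacian (\<lambda>y. v y t) x + a2 * v x t / (1 + k x * u x t)
             - b2 * (v x t)\<^sup>2 - c2 * u x t * v x t)) (at t)) \<and>
     (\<forall>x\<in>frontier \<Omega>. \<forall>t>0.
        ((\<lambda>s. u (x + s *\<^sub>R \<nu> x) t) has_real_derivative 0) (at_left 0) \<and>
        ((\<lambda>s. v (x + s *\<^sub>R \<nu> x) t) has_real_derivative 0) (at_left 0)) \<and>
     (\<forall>x\<in>closure \<Omega>. u x 0 = c \<and> v x 0 = d)"

end

theory Submission
  imports Defs
begin

text \<open>
  The domain is only of class \<open>C\<^sup>1\<close>, so Hopf's boundary lemma is not available. It is replaced by
  a semiconcave barrier with positive outward slope along the boundary: the squared distance to the set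
  of points of depth at least \<open>\<rho>\<close>. Subtracting a small multiple of it pushes every maximum into the
  interior and costs only a bounded Laplacian, which gives a maximum principle for weakly coupled
  Neumann systems.

  Since the growth rate of \<open>v\<close> is at most \<open>a2 - b2 v - c2 u\<close>, the rectangle
  \<open>u \<ge> p, v \<le> q\<close> may be moved along any path on which \<open>b1 p + c1 q < a1\<close> and
  \<open>b2 q + c2 p > a2\<close>. These conditions are linear, so a segment is admissible as soon as its endpoints
  are. One endpoint lies near \<open>(0, a2/b2)\<close> and is reached after finite time, as \<open>c1/b2 < a1/a2\<close>;
  the other lies near \<open>(a1/b1, 0)\<close>, as \<open>b1/c2 < a1/a2\<close>. The upper bound for \<open>u\<close> comes from the
  logistic equation.
\<close>

subsection \<open>A semiconcave boundary barrier\<close>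

lemma ray_stays_in_open:
  fixes A C :: "real set"
  assumes A: "open A" and C: "open C" and disj: "A \<inter> C = {}"
    and cross: "\<And>s. 0 \<le> s \<Longrightarrow> s \<le> 1 \<Longrightarrow> s \<notin> A \<Longrightarrow> s \<notin> C \<Longrightarrow>
      \<exists>\<tau>>0. \<forall>h. 0 < h \<longrightarrow> h < \<tau> \<longrightarrow> s + h \<in> A \<and> s - h \<in> C"
    and start: "0 \<notin> A" "0 \<notin> C"
  shows "1 \<in> A"
proof (rule ccontr)
  assume "1 \<notin> A"
  obtain \<tau> where \<tau>: "\<tau> > 0" "\<And>h. 0 < h \<Longrightarrow> h < \<tau> \<Longrightarrow> h \<in> A"
    using cross[of 0] start by auto
  define \<rho> where "\<rho> = min \<tau> 1 / 2"
  have \<rho>: "0 < \<rho>" "\<rho> < 1" "\<rho> < \<tau>" using \<tau>(1) by (auto simp: \<rho>_def)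
  define S where "S = {\<rho>..1} - A"
  have "compact S" unfolding S_def using A by (intro compact_diff) auto
  moreover have "1 \<in> S" using \<open>1 \<notin> A\<close> \<rho> by (auto simp: S_def)
  ultimately obtain s0 where s0: "s0 \<in> S" "\<And>s. s \<in> S \<Longrightarrow> s0 \<le> s"
    using compact_attains_inf[of S] by blast
  have s0': "\<rho> \<le> s0" "s0 \<le> 1" "s0 \<notin> A" using s0(1) by (auto simp: S_def)
  have below: "s \<in> A" if "0 < s" "s < s0" for s
  proof (cases "s < \<rho>")
    case True then show ?thesis using \<tau>(2)[of s] that \<rho> by auto
  next
    case False then show ?thesis using s0(2)[of s] that s0' by (auto simp: S_def)
  qed
  have "\<exists>\<tau>>0. \<forall>h. 0 < h \<longrightarrow> h < \<tau> \<longrightarrow> s0 - h \<in> C"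
  proof (cases "s0 \<in> C")
    case True
    then obtain e where "e > 0" "ball s0 e \<subseteq> C" using C open_contains_ball by blast
    then show ?thesis by (intro exI[of _ e]) (auto simp: subset_iff dist_real_def)
  next
    case False
    then show ?thesis using cross[of s0] s0' \<rho> by auto
  qed
  then obtain e where e: "e > 0" "\<And>h. 0 < h \<Longrightarrow> h < e \<Longrightarrow> s0 - h \<in> C" by blast
  define h where "h = min e s0 / 2"
  have "0 < h" "h < e" "h < s0" using e(1) s0'(1) \<rho> by (auto simp: h_def)
  then have "s0 - h \<in> C" "s0 - h \<in> A" using e(2) below[of "s0 - h"] by auto
  then show False using disj by blast
qed

text \<open>The radius is uniform because it depends only on the modulus of continuity of the normal:
  a line in a cone direction crosses the boundary from inside to outside at every boundary point that it
  meets, hence at most once.\<close>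

lemma outward_unit_normal_uniform_cone:
  fixes \<Omega> :: "(real^'n) set"
  assumes op: "open \<Omega>" and bd: "bounded \<Omega>" and normal: "outward_unit_normal \<Omega> \<nu>" and e: "0 < \<epsilon>"
  obtains r where "r > 0"
    and "\<And>x z. x \<in> frontier \<Omega> \<Longrightarrow> dist x z < r \<Longrightarrow> (z - x) \<bullet> \<nu> x > \<epsilon> * norm (z - x) \<Longrightarrow> z \<notin> closure \<Omega>"
    and "\<And>x z. x \<in> frontier \<Omega> \<Longrightarrow> dist x z < r \<Longrightarrow> (z - x) \<bullet> \<nu> x < - \<epsilon> * norm (z - x) \<Longrightarrow> z \<in> \<Omega>"
proof -
  have "compact (frontier \<Omega>)" using bd by (simp add: compact_frontier_bounded)
  moreover have "continuous_on (frontier \<Omega>) \<nu>" using normal by (simp add: outward_unit_normal_def)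
  ultimately have "uniformly_continuous_on (frontier \<Omega>) \<nu>" by (rule compact_uniformly_continuous[rotated])
  then obtain r where r: "r > 0"
    "\<And>x p. x \<in> frontier \<Omega> \<Longrightarrow> p \<in> frontier \<Omega> \<Longrightarrow> dist p x < r \<Longrightarrow> dist (\<nu> p) (\<nu> x) < \<epsilon> / 2"
    using e unfolding uniformly_continuous_on_def by (metis half_gt_zero)
  have fr: "p \<in> frontier \<Omega> \<longleftrightarrow> p \<notin> \<Omega> \<and> p \<in> closure \<Omega>" for p
    using op by (auto simp: frontier_def interior_open)
  have local: "\<exists>\<tau>>0. \<forall>h. 0 < h \<longrightarrow> h < \<tau> \<longrightarrow> p + h *\<^sub>R w \<notin> closure \<Omega> \<and> p - h *\<^sub>R w \<in> \<Omega>"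
    if p: "p \<in> frontier \<Omega>" "dist p x < r" and x: "x \<in> frontier \<Omega>" and w: "w \<bullet> \<nu> x > \<epsilon> * norm w" for p x w
  proof -
    have wn: "norm w > 0" using w by auto
    have "w \<bullet> (\<nu> x - \<nu> p) \<le> norm w * norm (\<nu> x - \<nu> p)" by (rule norm_cauchy_schwarz)
    also have "\<dots> \<le> norm w * (\<epsilon> / 2)"
      using r(2)[OF x p] by (intro mult_left_mono) (auto simp: dist_norm norm_minus_commute)
    finally have wp: "w \<bullet> \<nu> p > (\<epsilon> / 2) * norm w" using w by (simp add: inner_diff_right field_simps)
    from normal p(1) e obtain \<delta> where \<delta>: "\<delta> > 0" "\<And>y. y \<in> ball p \<delta> \<Longrightarrow>
        ((y - p) \<bullet> \<nu> p < - (\<epsilon>/2) * norm (y - p) \<longrightarrow> y \<in> \<Omega>) \<and>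
        ((y - p) \<bullet> \<nu> p > (\<epsilon>/2) * norm (y - p) \<longrightarrow> y \<notin> closure \<Omega>)"
      unfolding outward_unit_normal_def by (meson half_gt_zero)
    show ?thesis
    proof (intro exI[of _ "\<delta> / norm w"] conjI allI impI)
      show "0 < \<delta> / norm w" using \<delta> wn by simp
      fix h :: real assume h: "0 < h" "h < \<delta> / norm w"
      have hw: "h * norm w < \<delta>" using h wn by (simp add: pos_less_divide_eq)
      have m: "h * (w \<bullet> \<nu> p) > h * ((\<epsilon> / 2) * norm w)" using wp h(1) by simp
      show "p + h *\<^sub>R w \<notin> closure \<Omega>"
        using \<delta>(2)[of "p + h *\<^sub>R w"] hw h m by (auto simp: dist_norm algebra_simps)
      show "p - h *\<^sub>R w \<in> \<Omega>"
        using \<delta>(2)[of "p - h *\<^sub>R w"] hw h m by (auto simp: dist_norm algebra_simps)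
    qed
  qed
  have seg: "dist (x + s *\<^sub>R (z - x)) x < r" if "0 \<le> s" "s \<le> 1" "dist x z < r" for x z :: "real^'n" and s
  proof -
    have "s * norm (z - x) \<le> 1 * norm (z - x)" using that by (intro mult_right_mono) auto
    then show ?thesis using that by (simp add: dist_norm norm_minus_commute)
  qed
  have op1: "open ((\<lambda>s::real. x + s *\<^sub>R w) -` \<Omega>)" for x w
    by (rule continuous_open_vimage[OF op]) (intro continuous_intros)
  have op2: "open ((\<lambda>s::real. x + s *\<^sub>R w) -` (- closure \<Omega>))" for x w
    by (rule open_vimage) (auto intro!: continuous_intros)
  have disj: "\<Omega> \<inter> - closure \<Omega> = {}" using closure_subset by auto
  show thesis
  proof (rule that[OF r(1)])
    fix x z assume x: "x \<in> frontier \<Omega>" and d: "dist x z < r" and w: "(z - x) \<bullet> \<nu> x > \<epsilon> * norm (z - x)"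
    let ?f = "\<lambda>s::real. x + s *\<^sub>R (z - x)"
    have "1 \<in> ?f -` (- closure \<Omega>)"
    proof (rule ray_stays_in_open[OF op2 op1])
      fix s :: real assume s: "0 \<le> s" "s \<le> 1" "s \<notin> ?f -` (- closure \<Omega>)" "s \<notin> ?f -` \<Omega>"
      then have "?f s \<in> frontier \<Omega>" by (simp add: fr)
      from local[OF this seg[OF s(1,2) d] x w]
      show "\<exists>\<tau>>0. \<forall>h. 0 < h \<longrightarrow> h < \<tau> \<longrightarrow> s + h \<in> ?f -` (- closure \<Omega>) \<and> s - h \<in> ?f -` \<Omega>"
        by (simp add: algebra_simps)
    qed (use x fr disj in auto)
    then show "z \<notin> closure \<Omega>" by simp
  next
    fix x z assume x: "x \<in> frontier \<Omega>" and d: "dist x z < r" and w: "(z - x) \<bullet> \<nu> x < - \<epsilon> * norm (z - x)"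
    let ?f = "\<lambda>s::real. x + s *\<^sub>R (z - x)"
    have w': "(x - z) \<bullet> \<nu> x > \<epsilon> * norm (x - z)"
      using w by (simp add: norm_minus_commute inner_diff_left)
    have "1 \<in> ?f -` \<Omega>"
    proof (rule ray_stays_in_open[OF op1 op2])
      fix s :: real assume s: "0 \<le> s" "s \<le> 1" "s \<notin> ?f -` (- closure \<Omega>)" "s \<notin> ?f -` \<Omega>"
      then have "?f s \<in> frontier \<Omega>" by (simp add: fr)
      from local[OF this seg[OF s(1,2) d] x w'] obtain \<tau> where "\<tau> > 0"
        and \<tau>: "\<And>h. 0 < h \<Longrightarrow> h < \<tau> \<Longrightarrow> ?f s + h *\<^sub>R (x - z) \<notin> closure \<Omega> \<and> ?f s - h *\<^sub>R (x - z) \<in> \<Omega>"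
        by blast
      have "?f s + h *\<^sub>R (x - z) = ?f (s - h)" "?f s - h *\<^sub>R (x - z) = ?f (s + h)" for h
        by (simp_all add: algebra_simps)
      with \<open>\<tau> > 0\<close> \<tau> show "\<exists>\<tau>>0. \<forall>h. 0 < h \<longrightarrow> h < \<tau> \<longrightarrow> s + h \<in> ?f -` \<Omega> \<and> s - h \<in> ?f -` (- closure \<Omega>)"
        by (intro exI[of _ \<tau>]) auto
    qed (use x fr disj in auto)
    then show "z \<in> \<Omega>" by simp
  qed
qed

lemma semiconcave_barrier:
  fixes \<Omega> :: "(real^'n) set"
  assumes op: "open \<Omega>" and bd: "bounded \<Omega>" and ne: "\<Omega> \<noteq> {}" and normal: "outward_unit_normal \<Omega> \<nu>"
  obtains h :: "real^'n \<Rightarrow> real" where "continuous_on UNIV h" and "\<And>x. 0 \<le> h x"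
    and "\<And>x. \<exists>q. (\<forall>y. h y \<le> h x + 2 * (q \<bullet> (y - x)) + (norm (y - x))\<^sup>2) \<and> (x \<in> frontier \<Omega> \<longrightarrow> q \<bullet> \<nu> x > 0)"
proof -
  obtain r where r: "r > 0"
    "\<And>x z. x \<in> frontier \<Omega> \<Longrightarrow> dist x z < r \<Longrightarrow> (z - x) \<bullet> \<nu> x > 1/10 * norm (z - x) \<Longrightarrow> z \<notin> closure \<Omega>"
    "\<And>x z. x \<in> frontier \<Omega> \<Longrightarrow> dist x z < r \<Longrightarrow> (z - x) \<bullet> \<nu> x < - (1/10) * norm (z - x) \<Longrightarrow> z \<in> \<Omega>"
    using outward_unit_normal_uniform_cone[OF op bd normal, of "1/10"] by auto
  define \<rho> where "\<rho> = r / 4"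
  have \<rho>: "\<rho> > 0" "3 * \<rho> < r" using r(1) by (auto simp: \<rho>_def)
  have nu: "norm (\<nu> x) = 1" if "x \<in> frontier \<Omega>" for x
    using normal that by (simp add: outward_unit_normal_def)
  define K where "K = (\<Inter>z\<in>-\<Omega>. - ball z \<rho>)"
  have Kiff: "y \<in> K \<longleftrightarrow> (\<forall>z. z \<notin> \<Omega> \<longrightarrow> \<rho> \<le> dist z y)" for y
    by (auto simp: K_def not_less)
  have clK: "closed K" unfolding K_def by (intro closed_INT ballI) (simp add: closed_Compl)
  have near: "x - (2 * \<rho>) *\<^sub>R \<nu> x \<in> K" if x: "x \<in> frontier \<Omega>" for x
  proof (subst Kiff, intro allI impI, rule ccontr)
    fix z assume z: "z \<notin> \<Omega>" and "\<not> \<rho> \<le> dist z (x - (2 * \<rho>) *\<^sub>R \<nu> x)"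
    define y where "y = z - (x - (2 * \<rho>) *\<^sub>R \<nu> x)"
    have y: "norm y < \<rho>" and zx: "z - x = y - (2 * \<rho>) *\<^sub>R \<nu> x"
      using \<open>\<not> \<rho> \<le> _\<close> by (auto simp: y_def dist_norm)
    have "norm (z - x) \<le> norm y + norm ((2 * \<rho>) *\<^sub>R \<nu> x)" unfolding zx by (rule norm_triangle_ineq4)
    then have n: "norm (z - x) < 3 * \<rho>" using y nu[OF x] \<rho> by simp
    have "y \<bullet> \<nu> x \<le> norm y * norm (\<nu> x)" by (rule norm_cauchy_schwarz)
    then have "(z - x) \<bullet> \<nu> x < - \<rho>"
      using y nu[OF x] unfolding zx by (simp add: inner_diff_left dot_square_norm)
    then have "z \<in> \<Omega>" using r(3)[OF x, of z] n \<rho> by (simp add: dist_norm norm_minus_commute)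
    then show False using z by simp
  qed
  have "frontier \<Omega> \<noteq> {}"
    using bd ne op by (metis frontier_not_empty not_bounded_UNIV)
  then have Kne: "K \<noteq> {}" using near by blast
  define h where "h = (\<lambda>x. (infdist x K)\<^sup>2)"
  show thesis
  proof (rule that[of h])
    show "continuous_on UNIV h" unfolding h_def by (intro continuous_intros)
    show "0 \<le> h x" for x by (simp add: h_def)
    fix x
    obtain y0 where y0: "y0 \<in> K" "infdist x K = dist x y0"
      using infdist_attains_inf[OF clK Kne] by blast
    show "\<exists>q. (\<forall>y. h y \<le> h x + 2 * (q \<bullet> (y - x)) + (norm (y - x))\<^sup>2) \<and> (x \<in> frontier \<Omega> \<longrightarrow> q \<bullet> \<nu> x > 0)"
    proof (intro exI[of _ "x - y0"] conjI allI impI)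
      fix y
      have "h y \<le> (dist y y0)\<^sup>2"
        unfolding h_def using infdist_le[OF y0(1)] by (intro power_mono) (auto simp: infdist_nonneg)
      also have "\<dots> = (norm ((x - y0) + (y - x)))\<^sup>2" by (simp add: dist_norm)
      also have "\<dots> = h x + 2 * ((x - y0) \<bullet> (y - x)) + (norm (y - x))\<^sup>2"
        unfolding h_def y0(2) dist_norm power2_norm_eq_inner inner_add_left inner_add_right
        by (simp add: inner_commute)
      finally show "h y \<le> h x + 2 * ((x - y0) \<bullet> (y - x)) + (norm (y - x))\<^sup>2" .
    next
      assume x: "x \<in> frontier \<Omega>"
      show "(x - y0) \<bullet> \<nu> x > 0"
      proof (rule ccontr)
        assume neg: "\<not> (x - y0) \<bullet> \<nu> x > 0"
        define z where "z = y0 + (\<rho> / 2) *\<^sub>R \<nu> x"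
        have "dist x y0 \<le> dist x (x - (2 * \<rho>) *\<^sub>R \<nu> x)"
          using infdist_le[OF near[OF x], of x] y0(2) by simp
        then have d: "norm (y0 - x) \<le> 2 * \<rho>"
          using nu[OF x] \<rho> by (simp add: dist_norm norm_minus_commute)
        have zx: "z - x = (y0 - x) + (\<rho> / 2) *\<^sub>R \<nu> x" by (simp add: z_def)
        have "norm (z - x) \<le> norm (y0 - x) + norm ((\<rho> / 2) *\<^sub>R \<nu> x)" unfolding zx by (rule norm_triangle_ineq)
        then have n: "norm (z - x) < 3 * \<rho>" using d nu[OF x] \<rho> by simp
        have "(z - x) \<bullet> \<nu> x \<ge> \<rho> / 2"
          using neg nu[OF x] unfolding zx by (simp add: inner_add_left inner_diff_left dot_square_norm)
        then have "z \<notin> closure \<Omega>" using r(2)[OF x, of z] n \<rho> by (simp add: dist_norm norm_minus_commute)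
        then have "z \<notin> \<Omega>" using closure_subset by blast
        then have "\<rho> \<le> dist z y0" using y0(1) Kiff by blast
        then show False using nu[OF x] \<rho> by (simp add: z_def dist_norm)
      qed
    qed
  qed
qed

subsection \<open>Laplacians at points touched by a paraboloid\<close>

lemma second_derivative_le_of_quadratic_bound:
  fixes g g' :: "real \<Rightarrow> real"
  assumes "e > 0"
    and g: "\<And>s. \<bar>s\<bar> < e \<Longrightarrow> (g has_real_derivative g' s) (at s)"
    and g2: "(g' has_real_derivative g2) (at 0)"
    and le: "\<And>s. \<bar>s\<bar> < e \<Longrightarrow> g s \<le> g 0 + A * s + B * s\<^sup>2"
  shows "g2 \<le> 2 * B"
proof (rule ccontr)
  assume contra: "\<not> g2 \<le> 2 * B"
  define G where "G s = g s - A * s - B * s\<^sup>2" for s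
  define G' where "G' s = g' s - A - 2 * B * s" for s
  have dG: "(G has_real_derivative G' s) (at s)" if "\<bar>s\<bar> < e" for s
    unfolding G_def G'_def by (auto intro!: derivative_eq_intros g that)
  have dG': "(G' has_real_derivative (g2 - 2 * B)) (at 0)"
    unfolding G'_def by (auto intro!: derivative_eq_intros g2)
  have max: "G s \<le> G 0" if "\<bar>s\<bar> < e" for s using le[OF that] by (simp add: G_def)
  have G0: "G' 0 = 0"
    using DERIV_local_max[OF dG \<open>e > 0\<close>] max \<open>e > 0\<close> by (auto simp: abs_minus_commute)
  obtain d where d: "d > 0" "\<And>h. 0 < h \<Longrightarrow> h < d \<Longrightarrow> G' 0 < G' (0 + h)"
    using DERIV_pos_inc_right[OF dG'] contra by auto
  define m where "m = min d e / 2"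
  have m: "0 < m" "m < d" "m < e" using d(1) \<open>e > 0\<close> by (auto simp: m_def)
  have "\<exists>z. 0 < z \<and> z < m \<and> G m - G 0 = (m - 0) * G' z"
    by (rule MVT2) (use m dG in auto)
  then obtain z where z: "0 < z" "z < m" "G m - G 0 = m * G' z" by auto
  have "G' z > 0" using d(2)[of z] z m G0 by auto
  then have "G m > G 0" using z m by (metis diff_gt_0_iff_gt mult_pos_pos)
  then show False using max[of m] m by auto
qed

lemma has_real_derivative_along_line:
  fixes f :: "real^'n \<Rightarrow> real"
  assumes "(\<lambda>r. f ((x + s *\<^sub>R a) + r *\<^sub>R a)) differentiable (at 0)"
  shows "((\<lambda>s. f (x + s *\<^sub>R a)) has_real_derivative deriv (\<lambda>r. f ((x + s *\<^sub>R a) + r *\<^sub>R a)) 0) (at s)"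
proof -
  have "((\<lambda>r. f ((x + s *\<^sub>R a) + r *\<^sub>R a)) has_real_derivative deriv (\<lambda>r. f ((x + s *\<^sub>R a) + r *\<^sub>R a)) 0) (at (s - s))"
    using assms by (simp add: DERIV_deriv_iff_real_differentiable)
  then have "((\<lambda>r. f ((x + s *\<^sub>R a) + (r - s) *\<^sub>R a)) has_real_derivative deriv (\<lambda>r. f ((x + s *\<^sub>R a) + r *\<^sub>R a)) 0) (at s)"
    using DERIV_shift[of "\<lambda>r. f ((x + s *\<^sub>R a) + r *\<^sub>R a)" _ s "- s"] by simp
  then show ?thesis by (simp add: algebra_simps)
qed

lemma C2_on_has_pdiff:
  assumes "C2_on U f" and "x + s *\<^sub>R axis i 1 \<in> U"
  shows "((\<lambda>s. f (x + s *\<^sub>R axis i 1)) has_real_derivative pdiff f i (x + s *\<^sub>R axis i 1)) (at s)"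
    and "((\<lambda>s. pdiff f j (x + s *\<^sub>R axis i 1)) has_real_derivative
            pdiff (pdiff f j) i (x + s *\<^sub>R axis i 1)) (at s)"
  using assms unfolding C2_on_def pdiff_def[of f i] pdiff_def[of "pdiff f j" i]
  by (auto intro!: has_real_derivative_along_line)

lemma open_contains_line_nhd:
  fixes U :: "(real^'n) set"
  assumes "open U" "x \<in> U"
  obtains e where "e > 0" "\<And>s. \<bar>s\<bar> < e \<Longrightarrow> x + s *\<^sub>R axis i 1 \<in> U"
proof -
  obtain e where "e > 0" "ball x e \<subseteq> U" using assms open_contains_ball by blast
  then show thesis by (intro that[of e]) (auto simp: subset_iff dist_norm)
qed

lemma laplacian_le_of_quadratic_bound:
  fixes f :: "real^'n \<Rightarrow> real"
  assumes C2: "C2_on U f" and U: "open U" "x \<in> U"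
    and le: "\<And>y. y \<in> U \<Longrightarrow> f y \<le> f x + q \<bullet> (y - x) + B * (norm (y - x))\<^sup>2"
  shows "laplacian f x \<le> 2 * B * real CARD('n)"
proof -
  have "pdiff (pdiff f i) i x \<le> 2 * B" for i
  proof -
    obtain e where e: "e > 0" "\<And>s. \<bar>s\<bar> < e \<Longrightarrow> x + s *\<^sub>R axis i 1 \<in> U"
      using open_contains_line_nhd[OF U] by blast
    show ?thesis
    proof (rule second_derivative_le_of_quadratic_bound[OF e(1)])
      show "((\<lambda>s. f (x + s *\<^sub>R axis i 1)) has_real_derivative pdiff f i (x + s *\<^sub>R axis i 1)) (at s)"
        if "\<bar>s\<bar> < e" for s by (rule C2_on_has_pdiff[OF C2 e(2)[OF that]])
      show "((\<lambda>s. pdiff f i (x + s *\<^sub>R axis i 1)) has_real_derivative pdiff (pdiff f i) i x) (at 0)"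
        using C2_on_has_pdiff(2)[OF C2, of x 0] U by simp
      show "f (x + s *\<^sub>R axis i 1) \<le> f (x + 0 *\<^sub>R axis i 1) + (q \<bullet> axis i 1) * s + B * s\<^sup>2"
        if "\<bar>s\<bar> < e" for s using le[OF e(2)[OF that]] by (simp add: algebra_simps)
    qed
  qed
  then have "laplacian f x \<le> (\<Sum>i\<in>(UNIV::'n set). 2 * B)"
    unfolding laplacian_def by (intro sum_mono)
  then show ?thesis by (simp add: mult.commute)
qed

lemma affine_pdiff:
  fixes f :: "real^'n \<Rightarrow> real"
  assumes "(\<lambda>s. f (x + s *\<^sub>R axis i 1)) differentiable (at 0)"
  shows "(\<lambda>s. \<sigma> * f (x + s *\<^sub>R axis i 1) + \<gamma>) differentiable (at 0)"
    and "pdiff (\<lambda>y. \<sigma> * f y + \<gamma>) i x = \<sigma> * pdiff f i x"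
proof -
  have "((\<lambda>s. f (x + s *\<^sub>R axis i 1)) has_real_derivative pdiff f i x) (at 0)"
    using assms by (simp add: pdiff_def DERIV_deriv_iff_real_differentiable)
  then have "((\<lambda>s. \<sigma> * f (x + s *\<^sub>R axis i 1) + \<gamma>) has_real_derivative \<sigma> * pdiff f i x) (at 0)"
    by (auto intro!: derivative_eq_intros)
  then show "(\<lambda>s. \<sigma> * f (x + s *\<^sub>R axis i 1) + \<gamma>) differentiable (at 0)"
    and "pdiff (\<lambda>y. \<sigma> * f y + \<gamma>) i x = \<sigma> * pdiff f i x"
    by (auto simp: real_differentiable_def pdiff_def intro: DERIV_imp_deriv)
qed

lemma pdiff_cong:
  fixes f g :: "real^'n \<Rightarrow> real"
  assumes U: "open U" "x \<in> U" and eq: "\<And>y. y \<in> U \<Longrightarrow> f y = g y"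
  shows "pdiff f i x = pdiff g i x"
    and "(\<lambda>s. f (x + s *\<^sub>R axis i 1)) differentiable (at 0) \<longleftrightarrow> (\<lambda>s. g (x + s *\<^sub>R axis i 1)) differentiable (at 0)"
proof -
  obtain e where e: "e > 0" "\<And>s. \<bar>s\<bar> < e \<Longrightarrow> x + s *\<^sub>R axis i 1 \<in> U"
    using open_contains_line_nhd[OF U] by blast
  have ev: "\<forall>\<^sub>F s in nhds 0. f (x + s *\<^sub>R axis i 1) = g (x + s *\<^sub>R axis i 1)"
    unfolding eventually_nhds_metric using e eq by (intro exI[of _ e]) auto
  show "pdiff f i x = pdiff g i x"
    unfolding pdiff_def using ev by (intro deriv_cong_ev) auto
  show "(\<lambda>s. f (x + s *\<^sub>R axis i 1)) differentiable (at 0) \<longleftrightarrow> (\<lambda>s. g (x + s *\<^sub>R axis i 1)) differentiable (at 0)"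
    unfolding real_differentiable_def using DERIV_cong_ev[OF refl ev refl] by auto
qed

lemma C2_on_affine:
  fixes f :: "real^'n \<Rightarrow> real"
  assumes U: "open U" and C2: "C2_on U f"
  shows "C2_on U (\<lambda>y. \<sigma> * f y + \<gamma>)"
    and "x \<in> U \<Longrightarrow> laplacian (\<lambda>y. \<sigma> * f y + \<gamma>) x = \<sigma> * laplacian f x"
proof -
  let ?g = "\<lambda>y. \<sigma> * f y + \<gamma>"
  have d1: "(\<lambda>s. f (x + s *\<^sub>R axis i 1)) differentiable (at 0)"
    and d2: "(\<lambda>s. pdiff f j (x + s *\<^sub>R axis i 1)) differentiable (at 0)" if "x \<in> U" for x i j
    using C2 that by (auto simp: C2_on_def)
  have p1: "pdiff ?g i x = \<sigma> * pdiff f i x + 0" if "x \<in> U" for x i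
    using affine_pdiff(2)[OF d1[OF that]] by simp
  have p2: "pdiff (pdiff ?g j) i x = \<sigma> * pdiff (pdiff f j) i x" if "x \<in> U" for x i j
    using pdiff_cong(1)[OF U that, where f = "pdiff ?g j" and g = "\<lambda>y. \<sigma> * pdiff f j y + 0", OF p1]
      affine_pdiff(2)[OF d2[OF that, of j i], where \<sigma> = \<sigma> and \<gamma> = 0] by simp
  have e2: "(\<lambda>s. pdiff ?g j (x + s *\<^sub>R axis i 1)) differentiable (at 0)" if "x \<in> U" for x i j
    using pdiff_cong(2)[OF U that, where f = "pdiff ?g j" and g = "\<lambda>y. \<sigma> * pdiff f j y + 0", OF p1]
      affine_pdiff(1)[OF d2[OF that, of j i], where \<sigma> = \<sigma> and \<gamma> = 0] by simp
  have c: "continuous_on U f" "continuous_on U (pdiff f i)" "continuous_on U (pdiff (pdiff f i) j)" for i j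
    using C2 by (auto simp: C2_on_def)
  have c1: "continuous_on U (pdiff ?g i)" for i
    using c(2)[of i] p1 by (subst continuous_on_cong[OF refl p1]) (auto intro!: continuous_intros)
  have c2: "continuous_on U (pdiff (pdiff ?g i) j)" for i j
    using c(3)[of i j] by (subst continuous_on_cong[OF refl p2]) (auto intro!: continuous_intros)
  show "C2_on U ?g"
    unfolding C2_on_def using c(1) c1 c2 e2 affine_pdiff(1)[OF d1] by (auto intro!: continuous_intros)
  show "laplacian ?g x = \<sigma> * laplacian f x" if "x \<in> U"
    unfolding laplacian_def using p2[OF that] by (simp add: sum_distrib_left)
qed

subsection \<open>Maximum principle and comparison\<close>

text \<open>The differential inequality is only needed where component \<open>i\<close> is positive and dominates the
  others, which is how quasimonotone coupling enters.\<close>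

lemma weakly_coupled_maximum_principle:
  fixes \<Omega> :: "(real^'n) set" and w :: "'i \<Rightarrow> real^'n \<Rightarrow> real \<Rightarrow> real"
  assumes op: "open \<Omega>" and bd: "bounded \<Omega>" and ne: "\<Omega> \<noteq> {}" and normal: "outward_unit_normal \<Omega> \<nu>"
    and I: "finite I" and D: "\<And>i. i \<in> I \<Longrightarrow> 0 \<le> D i"
    and cont: "\<And>i. i \<in> I \<Longrightarrow> continuous_on (closure \<Omega> \<times> {t0..T}) (\<lambda>(x,t). w i x t)"
    and C2: "\<And>i t. i \<in> I \<Longrightarrow> t0 < t \<Longrightarrow> t \<le> T \<Longrightarrow> C2_on \<Omega> (\<lambda>x. w i x t)"
    and evol: "\<And>i x t. i \<in> I \<Longrightarrow> x \<in> \<Omega> \<Longrightarrow> t0 < t \<Longrightarrow> t \<le> T \<Longrightarrow> 0 < w i x t \<Longrightarrow>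
      (\<forall>j\<in>I. w j x t \<le> w i x t) \<Longrightarrow>
      \<exists>w'. ((\<lambda>s. w i x s) has_real_derivative w') (at t) \<and>
           w' \<le> D i * laplacian (\<lambda>y. w i y t) x + L * w i x t"
    and neumann: "\<And>i x t. i \<in> I \<Longrightarrow> x \<in> frontier \<Omega> \<Longrightarrow> t0 < t \<Longrightarrow> t \<le> T \<Longrightarrow>
      ((\<lambda>s. w i (x + s *\<^sub>R \<nu> x) t) has_real_derivative 0) (at_left 0)"
    and init: "\<And>i x. i \<in> I \<Longrightarrow> x \<in> closure \<Omega> \<Longrightarrow> w i x t0 \<le> 0"
    and i: "i \<in> I" and x: "x \<in> closure \<Omega>" and t: "t0 \<le> t" "t \<le> T"
  shows "w i x t \<le> 0"
proof (rule ccontr)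
  assume pos: "\<not> w i x t \<le> 0"
  obtain h :: "real^'n \<Rightarrow> real" where hc: "continuous_on UNIV h" and h0: "\<And>x. 0 \<le> h x"
    and hq: "\<And>x. \<exists>q. (\<forall>y. h y \<le> h x + 2 * (q \<bullet> (y - x)) + (norm (y - x))\<^sup>2) \<and> (x \<in> frontier \<Omega> \<longrightarrow> q \<bullet> \<nu> x > 0)"
    using semiconcave_barrier[OF op bd ne normal] by blast
  define C where "C = 1 + (\<Sum>j\<in>I. 2 * D j * real CARD('n))"
  have CD: "2 * D j * real CARD('n) < C" if "j \<in> I" for j
    unfolding C_def using member_le_sum[OF that, of "\<lambda>j. 2 * D j * real CARD('n)"] I D by fastforce
  have C0: "C > 0" unfolding C_def using D by (auto intro!: add_pos_nonneg sum_nonneg)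
  define E where "E s = exp (- (L * s))" for s
  have E0: "E s > 0" for s by (simp add: E_def)
  define \<beta> where "\<beta> = h x + C * (t - t0)"
  have \<beta>0: "\<beta> \<ge> 0" using h0 C0 t by (simp add: \<beta>_def)
  define \<eta> where "\<eta> = E t * w i x t / (1 + \<beta>)"
  have wp: "E t * w i x t > 0" using pos E0 by simp
  have \<eta>: "\<eta> > 0" using wp \<beta>0 by (simp add: \<eta>_def)
  have "\<eta> * (1 + \<beta>) = E t * w i x t" using \<beta>0 by (simp add: \<eta>_def)
  then have \<eta>\<beta>: "\<eta> * \<beta> < E t * w i x t" using \<eta> by (simp add: algebra_simps)
  define \<Phi> where "\<Phi> j = (\<lambda>(y,s). E s * w j y s - \<eta> * (h y + C * (s - t0)))" for j
  let ?Q = "closure \<Omega> \<times> {t0..T}"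
  have Q: "compact ?Q" "?Q \<noteq> {}" using bd x t by (auto intro!: compact_Times simp: compact_closure)
  have hQ: "continuous_on ?Q (\<lambda>p. h (fst p))"
    by (rule continuous_on_compose2[OF hc]) (auto intro!: continuous_intros)
  have \<Phi>c: "continuous_on ?Q (\<Phi> j)" if "j \<in> I" for j
    using cont[OF that] hQ unfolding \<Phi>_def E_def case_prod_beta by (intro continuous_intros) auto
  have "\<forall>j\<in>I. \<exists>p\<in>?Q. \<forall>p'\<in>?Q. \<Phi> j p' \<le> \<Phi> j p"
    using continuous_attains_sup[OF Q \<Phi>c] by blast
  then obtain P where P: "\<And>j. j \<in> I \<Longrightarrow> P j \<in> ?Q" "\<And>j p'. j \<in> I \<Longrightarrow> p' \<in> ?Q \<Longrightarrow> \<Phi> j p' \<le> \<Phi> j (P j)"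
    by metis
  obtain m where m: "m \<in> I" "\<And>j. j \<in> I \<Longrightarrow> \<Phi> j (P j) \<le> \<Phi> m (P m)"
    using obtains_MAX[OF I, of "\<lambda>j. \<Phi> j (P j)"] i by (metis (no_types, lifting) I Max_ge empty_iff finite_imageI imageI)
  obtain y s where ys: "P m = (y, s)" by fastforce
  have yQ: "y \<in> closure \<Omega>" "t0 \<le> s" "s \<le> T" using P(1)[OF m(1)] ys by auto
  have max: "\<Phi> j (z, r) \<le> \<Phi> m (y, s)" if "j \<in> I" "z \<in> closure \<Omega>" "t0 \<le> r" "r \<le> T" for j z r
    using P(2)[OF that(1), of "(z, r)"] m(2)[OF that(1)] that ys by auto
  have "0 < \<Phi> i (x, t)" using \<eta>\<beta> by (simp add: \<Phi>_def \<beta>_def)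
  then have pos\<Phi>: "0 < \<Phi> m (y, s)" using max[OF i x t] by linarith
  have "0 \<le> \<eta> * (h y + C * (s - t0))" using \<eta> h0 C0 yQ by simp
  then have "0 < E s * w m y s" using pos\<Phi> by (simp add: \<Phi>_def)
  then have wpos: "0 < w m y s" using E0[of s] by (simp add: zero_less_mult_iff)
  then have s: "t0 < s" using init[OF m(1) yQ(1)] yQ(2) by (cases "s = t0") auto
  have dom: "\<forall>j\<in>I. w j y s \<le> w m y s"
  proof
    fix j assume "j \<in> I"
    then have "E s * w j y s \<le> E s * w m y s" using max[of j y s] yQ by (simp add: \<Phi>_def)
    then show "w j y s \<le> w m y s" using E0[of s] by simp
  qed
  obtain q where q: "\<And>z. h z \<le> h y + 2 * (q \<bullet> (z - y)) + (norm (z - y))\<^sup>2" "y \<in> frontier \<Omega> \<Longrightarrow> q \<bullet> \<nu> y > 0"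
    using hq[of y] by blast
  define B where "B = \<eta> / E s"
  have B: "B > 0" "E s * B = \<eta>" using \<eta> E0[of s] by (auto simp: B_def)
  have space: "w m z s \<le> w m y s + (2 * B) *\<^sub>R q \<bullet> (z - y) + B * (norm (z - y))\<^sup>2" if "z \<in> closure \<Omega>" for z
  proof -
    have "E s * w m z s \<le> E s * w m y s + \<eta> * (h z - h y)"
      using max[OF m(1) that yQ(2,3)] by (simp add: \<Phi>_def algebra_simps)
    also have "\<dots> \<le> E s * w m y s + \<eta> * (2 * (q \<bullet> (z - y)) + (norm (z - y))\<^sup>2)"
      using q(1)[of z] \<eta> by (intro add_left_mono mult_left_mono) auto
    also have "\<dots> = E s * (w m y s + (2 * B) *\<^sub>R q \<bullet> (z - y) + B * (norm (z - y))\<^sup>2)"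
      unfolding B(2)[symmetric] by (simp add: algebra_simps)
    finally show ?thesis using E0[of s] by simp
  qed
  show False
  proof (cases "y \<in> frontier \<Omega>")
    case True
    have nu: "norm (\<nu> y) = 1" using normal True by (simp add: outward_unit_normal_def)
    from normal True obtain \<delta> where \<delta>: "\<delta> > 0" "\<And>z. z \<in> ball y \<delta> \<Longrightarrow>
        (z - y) \<bullet> \<nu> y < - (1/2) * norm (z - y) \<Longrightarrow> z \<in> \<Omega>"
      unfolding outward_unit_normal_def by (metis half_gt_zero zero_less_one)
    have inside: "y + r *\<^sub>R \<nu> y \<in> closure \<Omega>" if "- \<delta> < r" "r < 0" for r
    proof -
      have "y + r *\<^sub>R \<nu> y \<in> \<Omega>"
        by (rule \<delta>(2)) (use that nu in \<open>auto simp: dist_norm dot_square_norm\<close>)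
      then show ?thesis using closure_subset by blast
    qed
    have lim: "((\<lambda>r. (w m (y + r *\<^sub>R \<nu> y) s - w m y s) / r) \<longlongrightarrow> 0) (at_left 0)"
      using neumann[OF m(1) True s yQ(3)] by (simp add: has_field_derivative_iff)
    have ev: "\<forall>\<^sub>F r in at_left 0. 2 * B * (q \<bullet> \<nu> y) + B * r \<le> (w m (y + r *\<^sub>R \<nu> y) s - w m y s) / r"
      unfolding eventually_at_left_field
    proof (intro exI[of _ "- \<delta>"] conjI allI impI)
      fix r :: real assume r: "- \<delta> < r" "r < 0"
      have "w m (y + r *\<^sub>R \<nu> y) s - w m y s \<le> (2 * B * (q \<bullet> \<nu> y) + B * r) * r"
        using space[OF inside[OF r]] nu by (simp add: algebra_simps power2_eq_square)
      then show "2 * B * (q \<bullet> \<nu> y) + B * r \<le> (w m (y + r *\<^sub>R \<nu> y) s - w m y s) / r"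
        using r by (simp add: neg_le_divide_eq)
    qed (use \<delta> in auto)
    have "((\<lambda>r. 2 * B * (q \<bullet> \<nu> y) + B * r) \<longlongrightarrow> 2 * B * (q \<bullet> \<nu> y) + B * 0) (at_left (0::real))"
      by (intro tendsto_intros)
    then have "2 * B * (q \<bullet> \<nu> y) + B * 0 \<le> 0"
      by (rule tendsto_le[OF trivial_limit_at_left_real lim _ ev])
    then show False using B(1) q(2)[OF True] by (simp add: mult_le_0_iff)
  next
    case False
    then have y: "y \<in> \<Omega>" using yQ(1) op by (auto simp: frontier_def interior_open)
    have lap: "laplacian (\<lambda>z. w m z s) y \<le> 2 * B * real CARD('n)"
      by (rule laplacian_le_of_quadratic_bound[OF C2[OF m(1) s yQ(3)] op y, where q = "(2 * B) *\<^sub>R q"])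
        (use space closure_subset in blast)
    obtain w' where w': "((\<lambda>s. w m y s) has_real_derivative w') (at s)"
      "w' \<le> D m * laplacian (\<lambda>z. w m z s) y + L * w m y s"
      using evol[OF m(1) y s yQ(3) wpos dom] by blast
    define G where "G r = E r * w m y r - \<eta> * C * r" for r
    have dG: "(G has_real_derivative (E s * (w' - L * w m y s) - \<eta> * C)) (at s)"
      unfolding G_def E_def by (auto intro!: derivative_eq_intros w'(1) simp: algebra_simps)
    have "E s * (w' - L * w m y s) - \<eta> * C \<ge> 0"
    proof (rule ccontr)
      assume "\<not> ?thesis"
      then obtain e where e: "e > 0" "\<And>r. 0 < r \<Longrightarrow> r < e \<Longrightarrow> G s < G (s - r)"
        using DERIV_neg_dec_left[OF dG] by auto
      define r where "r = min e (s - t0) / 2"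
      have r: "0 < r" "r < e" "r < s - t0" using e(1) s by (auto simp: r_def)
      have "\<Phi> m (y, s - r) \<le> \<Phi> m (y, s)" by (rule max) (use m yQ r in auto)
      then have "G (s - r) \<le> G s" by (simp add: \<Phi>_def G_def algebra_simps)
      then show False using e(2)[OF r(1,2)] by simp
    qed
    moreover have "E s * (w' - L * w m y s) \<le> E s * (D m * (2 * B * real CARD('n)))"
      using w'(2) mult_left_mono[OF lap D[OF m(1)]] E0[of s] by (intro mult_left_mono) auto
    moreover have "E s * (D m * (2 * B * real CARD('n))) = \<eta> * (2 * D m * real CARD('n))"
      unfolding B(2)[symmetric] by simp
    moreover have "\<eta> * (2 * D m * real CARD('n)) < \<eta> * C"
      using CD[OF m(1)] \<eta> by simp
    ultimately show False by linarith
  qed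
qed

definition neumann_regular :: "(real^'n) set \<Rightarrow> (real^'n \<Rightarrow> real^'n) \<Rightarrow> (real^'n \<Rightarrow> real \<Rightarrow> real) \<Rightarrow> bool" where
  "neumann_regular \<Omega> \<nu> z \<longleftrightarrow> continuous_on (closure \<Omega> \<times> {0..}) (\<lambda>(x,t). z x t) \<and>
     (\<forall>t>0. C2_on \<Omega> (\<lambda>x. z x t)) \<and>
     (\<forall>x\<in>frontier \<Omega>. \<forall>t>0. ((\<lambda>s. z (x + s *\<^sub>R \<nu> x) t) has_real_derivative 0) (at_left 0))"

lemma reaction_diffusion_comparison:
  fixes \<Omega> :: "(real^'n) set" and z :: "'i \<Rightarrow> real^'n \<Rightarrow> real \<Rightarrow> real"
  assumes op: "open \<Omega>" and bd: "bounded \<Omega>" and ne: "\<Omega> \<noteq> {}" and normal: "outward_unit_normal \<Omega> \<nu>"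
    and I: "finite I" and D: "\<And>i. i \<in> I \<Longrightarrow> 0 \<le> D i" and t0: "0 \<le> t0"
    and reg: "\<And>i. i \<in> I \<Longrightarrow> neumann_regular \<Omega> \<nu> (z i)"
    and evol: "\<And>i x t. i \<in> I \<Longrightarrow> x \<in> \<Omega> \<Longrightarrow> 0 < t \<Longrightarrow>
      ((\<lambda>s. z i x s) has_real_derivative D i * laplacian (\<lambda>y. z i y t) x + R i x t) (at t)"
    and \<phi>: "\<And>i t. i \<in> I \<Longrightarrow> (\<phi> i has_real_derivative \<phi>' i t) (at t)"
    and react: "\<And>i x t. i \<in> I \<Longrightarrow> x \<in> \<Omega> \<Longrightarrow> t0 < t \<Longrightarrow> t \<le> T \<Longrightarrow> 0 < \<sigma> i * z i x t + \<phi> i t \<Longrightarrow>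
      (\<forall>j\<in>I. \<sigma> j * z j x t + \<phi> j t \<le> \<sigma> i * z i x t + \<phi> i t) \<Longrightarrow>
      \<sigma> i * R i x t + \<phi>' i t \<le> L * (\<sigma> i * z i x t + \<phi> i t)"
    and init: "\<And>i x. i \<in> I \<Longrightarrow> x \<in> closure \<Omega> \<Longrightarrow> \<sigma> i * z i x t0 + \<phi> i t0 \<le> 0"
    and i: "i \<in> I" and x: "x \<in> closure \<Omega>" and t: "t0 \<le> t" "t \<le> T"
  shows "\<sigma> i * z i x t + \<phi> i t \<le> 0"
proof (rule weakly_coupled_maximum_principle[where w = "\<lambda>i x t. \<sigma> i * z i x t + \<phi> i t" and L = L and D = D,
        OF op bd ne normal I])
  fix i assume i: "i \<in> I"
  have "continuous_on {t0..T} (\<phi> i)"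
    using \<phi>[OF i] by (meson DERIV_continuous_on has_field_derivative_at_within)
  then have "continuous_on (closure \<Omega> \<times> {t0..T}) (\<lambda>p. \<phi> i (snd p))"
    by (rule continuous_on_compose2) (auto intro!: continuous_intros)
  moreover have "continuous_on (closure \<Omega> \<times> {t0..T}) (\<lambda>(x,t). z i x t)"
    using reg[OF i] t0 by (auto simp: neumann_regular_def elim!: continuous_on_subset)
  ultimately show "continuous_on (closure \<Omega> \<times> {t0..T}) (\<lambda>(x,t). \<sigma> i * z i x t + \<phi> i t)"
    unfolding case_prod_beta by (intro continuous_intros)
  fix t assume t: "t0 < t" "t \<le> T"
  have C2: "C2_on \<Omega> (\<lambda>y. z i y t)" using reg[OF i] t0 t by (auto simp: neumann_regular_def)
  show "C2_on \<Omega> (\<lambda>x. \<sigma> i * z i x t + \<phi> i t)" by (rule C2_on_affine(1)[OF op C2])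
  fix x
  show "((\<lambda>s. \<sigma> i * z i (x + s *\<^sub>R \<nu> x) t + \<phi> i t) has_real_derivative 0) (at_left 0)" if "x \<in> frontier \<Omega>"
  proof -
    have "((\<lambda>s. z i (x + s *\<^sub>R \<nu> x) t) has_real_derivative 0) (at_left 0)"
      using reg[OF i] that t t0 by (auto simp: neumann_regular_def)
    then show ?thesis by (auto intro!: derivative_eq_intros)
  qed
  assume x: "x \<in> \<Omega>" and dom: "0 < \<sigma> i * z i x t + \<phi> i t"
    "\<forall>j\<in>I. \<sigma> j * z j x t + \<phi> j t \<le> \<sigma> i * z i x t + \<phi> i t"
  have "((\<lambda>s. \<sigma> i * z i x s + \<phi> i s) has_real_derivative
      \<sigma> i * (D i * laplacian (\<lambda>y. z i y t) x + R i x t) + \<phi>' i t) (at t)"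
    using evol[OF i x, of t] \<phi>[OF i, of t] t t0 by (auto intro!: derivative_eq_intros)
  moreover have "\<sigma> i * (D i * laplacian (\<lambda>y. z i y t) x + R i x t) + \<phi>' i t \<le>
      D i * (\<sigma> i * laplacian (\<lambda>y. z i y t) x) + L * (\<sigma> i * z i x t + \<phi> i t)"
    using react[OF i x t dom] by (simp add: algebra_simps)
  ultimately show "\<exists>w'. ((\<lambda>s. \<sigma> i * z i x s + \<phi> i s) has_real_derivative w') (at t) \<and>
      w' \<le> D i * laplacian (\<lambda>y. \<sigma> i * z i y t + \<phi> i t) x + L * (\<sigma> i * z i x t + \<phi> i t)"
    unfolding C2_on_affine(2)[OF op C2 x] by blast
qed (use D init i x t in auto)

corollary scalar_comparison:
  fixes \<Omega> :: "(real^'n) set" and z :: "real^'n \<Rightarrow> real \<Rightarrow> real"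
  assumes op: "open \<Omega>" and bd: "bounded \<Omega>" and ne: "\<Omega> \<noteq> {}" and normal: "outward_unit_normal \<Omega> \<nu>"
    and D: "0 \<le> D" and reg: "neumann_regular \<Omega> \<nu> z"
    and evol: "\<And>x t. x \<in> \<Omega> \<Longrightarrow> 0 < t \<Longrightarrow>
      ((\<lambda>s. z x s) has_real_derivative D * laplacian (\<lambda>y. z y t) x + R x t) (at t)"
    and \<phi>: "\<And>t. (\<phi> has_real_derivative \<phi>' t) (at t)"
    and react: "\<And>x t. x \<in> \<Omega> \<Longrightarrow> 0 < t \<Longrightarrow> t \<le> T \<Longrightarrow> 0 < \<sigma> * z x t + \<phi> t \<Longrightarrow>
      \<sigma> * R x t + \<phi>' t \<le> L * (\<sigma> * z x t + \<phi> t)"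
    and init: "\<And>x. x \<in> closure \<Omega> \<Longrightarrow> \<sigma> * z x 0 + \<phi> 0 \<le> 0"
    and x: "x \<in> closure \<Omega>" and t: "0 \<le> t" "t \<le> T"
  shows "\<sigma> * z x t + \<phi> t \<le> 0"
  by (rule reaction_diffusion_comparison[where I = "{()}" and z = "\<lambda>_. z" and \<phi> = "\<lambda>_. \<phi>" and \<sigma> = "\<lambda>_. \<sigma>"
        and D = "\<lambda>_. D" and R = "\<lambda>_. R" and \<phi>' = "\<lambda>_. \<phi>'" and ?t0.0 = 0 and L = L and i = "()",
        OF op bd ne normal]) (use assms in auto)

lemma logistic_upper_bound:
  fixes \<Omega> :: "(real^'n) set" and z :: "real^'n \<Rightarrow> real \<Rightarrow> real"
  assumes op: "open \<Omega>" and bd: "bounded \<Omega>" and ne: "\<Omega> \<noteq> {}" and normal: "outward_unit_normal \<Omega> \<nu>"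
    and D: "0 \<le> D" and reg: "neumann_regular \<Omega> \<nu> z"
    and evol: "\<And>x t. x \<in> \<Omega> \<Longrightarrow> 0 < t \<Longrightarrow>
      ((\<lambda>s. z x s) has_real_derivative D * laplacian (\<lambda>y. z y t) x + R x t) (at t)"
    and a: "0 < a" and b: "0 < b" and B: "0 \<le> B"
    and R: "\<And>x t. x \<in> \<Omega> \<Longrightarrow> 0 < t \<Longrightarrow> R x t \<le> z x t * (a - b * z x t)"
    and init: "\<And>x. x \<in> closure \<Omega> \<Longrightarrow> z x 0 \<le> B"
    and x: "x \<in> closure \<Omega>" and t: "0 \<le> t"
  shows "z x t \<le> a / b + B * exp (- (a * t))"
proof -
  have "1 * z x t + - (a / b + B * exp (- (a * t))) \<le> 0"
  proof (rule scalar_comparison[where \<phi>' = "\<lambda>t. a * B * exp (- (a * t))" and L = 0 and T = t,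
        OF op bd ne normal D reg evol])
    show "((\<lambda>t. - (a / b + B * exp (- (a * t)))) has_real_derivative a * B * exp (- (a * t))) (at t)" for t
      by (auto intro!: derivative_eq_intros)
    fix x s assume xs: "x \<in> \<Omega>" "0 < s" and pos: "0 < 1 * z x s + - (a / b + B * exp (- (a * s)))"
    define y where "y = B * exp (- (a * s))"
    have y: "0 \<le> y" "a / b + y < z x s" using B pos by (auto simp: y_def)
    then have "b * y \<le> b * z x s - a" using b by (auto simp: field_simps)
    moreover have "a / b \<le> z x s" using y by linarith
    ultimately have "(a / b) * (b * y) \<le> z x s * (b * z x s - a)"
      using a b y divide_pos_pos[OF a b] by (intro mult_mono mult_nonneg_nonneg) linarith+
    then have "a * y \<le> z x s * (b * z x s - a)" using b by simp
    moreover have "R x s \<le> - (z x s * (b * z x s - a))" using R[OF xs] by (simp add: algebra_simps)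
    ultimately show "1 * R x s + a * B * exp (- (a * s)) \<le> 0 * (1 * z x s + - (a / b + B * exp (- (a * s))))"
      by (simp add: y_def algebra_simps)
  next
    fix x assume "x \<in> closure \<Omega>"
    then show "1 * z x 0 + - (a / b + B * exp (- (a * 0))) \<le> 0"
      using init[of x] divide_pos_pos[OF a b] by simp
  qed (use x t in auto)
  then show ?thesis by simp
qed

lemma eventually_exp_decay:
  fixes A \<epsilon> \<sigma> s :: real
  assumes "0 < \<epsilon>" "0 < \<sigma>"
  shows "\<forall>\<^sub>F t in at_top. A * exp (- (\<sigma> * (t - s))) < \<epsilon>"
proof -
  have "filterlim (\<lambda>t. - s + t) at_top at_top"
    by (rule filterlim_tendsto_add_at_top[OF tendsto_const filterlim_ident])
  then have "filterlim (\<lambda>t. \<sigma> * (t - s)) at_top at_top"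
    using filterlim_tendsto_pos_mult_at_top[OF tendsto_const assms(2)] by fastforce
  then have "((\<lambda>t. A * exp (- (\<sigma> * (t - s)))) \<longlongrightarrow> A * 0) at_top"
    by (intro tendsto_intros filterlim_compose[OF exp_at_bot]) (simp add: filterlim_uminus_at_top)
  then show ?thesis using assms(1) by (intro order_tendstoD(2)) auto
qed

subsection \<open>The competition system\<close>

locale competition =
  fixes \<Omega> :: "(real^'n) set" and \<nu> :: "real^'n \<Rightarrow> real^'n" and k :: "real^'n \<Rightarrow> real"
    and u v :: "real^'n \<Rightarrow> real \<Rightarrow> real"
    and d1 d2 a1 a2 b1 b2 c1 c2 c d :: real
  assumes dom: "open \<Omega>" "bounded \<Omega>" "\<Omega> \<noteq> {}"
    and normal: "outward_unit_normal \<Omega> \<nu>"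
    and k_nonneg: "\<And>x. x \<in> closure \<Omega> \<Longrightarrow> 0 \<le> k x"
    and pos: "d1 > 0" "d2 > 0" "a1 > 0" "a2 > 0" "b1 > 0" "b2 > 0" "c1 > 0" "c2 > 0"
    and init_pos: "c > 0" "d > 0"
    and sol: "classical_solution \<Omega> \<nu> k d1 d2 a1 a2 b1 b2 c1 c2 c d u v"
begin

abbreviation "Ru x t \<equiv> u x t * (a1 - b1 * u x t - c1 * v x t)"
abbreviation "Rv x t \<equiv> v x t * (a2 / (1 + k x * u x t) - b2 * v x t - c2 * u x t)"

lemma u_regular: "neumann_regular \<Omega> \<nu> u" and v_regular: "neumann_regular \<Omega> \<nu> v"
  using sol by (auto simp: classical_solution_def neumann_regular_def)

lemma u_evol:
  assumes "x \<in> \<Omega>" "0 < t"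
  shows "((\<lambda>s. u x s) has_real_derivative d1 * laplacian (\<lambda>y. u y t) x + Ru x t) (at t)"
proof -
  have "((\<lambda>s. u x s) has_real_derivative
      (d1 * laplacian (\<lambda>y. u y t) x + a1 * u x t - b1 * (u x t)\<^sup>2 - c1 * u x t * v x t)) (at t)"
    using sol assms by (simp add: classical_solution_def)
  then show ?thesis by (rule back_subst) (simp add: algebra_simps power2_eq_square)
qed

lemma v_evol:
  assumes "x \<in> \<Omega>" "0 < t"
  shows "((\<lambda>s. v x s) has_real_derivative d2 * laplacian (\<lambda>y. v y t) x + Rv x t) (at t)"
proof -
  have "((\<lambda>s. v x s) has_real_derivative (d2 * laplacian (\<lambda>y. v y t) x + a2 * v x t / (1 + k x * u x t)
             - b2 * (v x t)\<^sup>2 - c2 * u x t * v x t)) (at t)"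
    using sol assms by (simp add: classical_solution_def)
  then show ?thesis by (rule back_subst) (simp add: algebra_simps power2_eq_square)
qed

lemma initial: "x \<in> closure \<Omega> \<Longrightarrow> u x 0 = c" "x \<in> closure \<Omega> \<Longrightarrow> v x 0 = d"
  using sol by (auto simp: classical_solution_def)

lemma bounded_on_finite_time:
  obtains M where "0 \<le> M"
    "\<And>x t. x \<in> closure \<Omega> \<Longrightarrow> 0 \<le> t \<Longrightarrow> t \<le> T \<Longrightarrow> \<bar>u x t\<bar> \<le> M \<and> \<bar>v x t\<bar> \<le> M"
proof -
  have bd: "\<exists>M. \<forall>x t. x \<in> closure \<Omega> \<longrightarrow> 0 \<le> t \<longrightarrow> t \<le> T \<longrightarrow> \<bar>z x t\<bar> \<le> M" if "neumann_regular \<Omega> \<nu> z" for z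
  proof -
    have "continuous_on (closure \<Omega> \<times> {0..T}) (\<lambda>(x,t). z x t)"
      using that by (auto simp: neumann_regular_def elim!: continuous_on_subset)
    moreover have "compact (closure \<Omega> \<times> {0..T})"
      using dom by (intro compact_Times) (auto simp: compact_closure)
    ultimately have "bounded ((\<lambda>(x,t). z x t) ` (closure \<Omega> \<times> {0..T}))"
      by (intro compact_imp_bounded compact_continuous_image)
    then show ?thesis unfolding bounded_iff by fastforce
  qed
  obtain M1 M2 where "\<And>x t. x \<in> closure \<Omega> \<Longrightarrow> 0 \<le> t \<Longrightarrow> t \<le> T \<Longrightarrow> \<bar>u x t\<bar> \<le> M1"
    "\<And>x t. x \<in> closure \<Omega> \<Longrightarrow> 0 \<le> t \<Longrightarrow> t \<le> T \<Longrightarrow> \<bar>v x t\<bar> \<le> M2"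
    using bd[OF u_regular] bd[OF v_regular] by blast
  then show thesis by (intro that[of "max 0 (max M1 M2)"]) fastforce+
qed

lemma in_closure: "x \<in> \<Omega> \<Longrightarrow> x \<in> closure \<Omega>"
  using closure_subset by blast

lemma u_nonneg:
  assumes x: "x \<in> closure \<Omega>" and t: "0 \<le> t"
  shows "0 \<le> u x t"
proof -
  obtain M where M: "0 \<le> M"
    "\<And>x s. x \<in> closure \<Omega> \<Longrightarrow> 0 \<le> s \<Longrightarrow> s \<le> t \<Longrightarrow> \<bar>u x s\<bar> \<le> M \<and> \<bar>v x s\<bar> \<le> M"
    using bounded_on_finite_time by blast
  have "-1 * u x t + 0 \<le> 0"
  proof (rule scalar_comparison[where \<phi>' = "\<lambda>_. 0" and \<phi> = "\<lambda>_. 0" and T = t and L = "a1 + b1 * M + c1 * M",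
        OF dom normal _ u_regular u_evol])
    fix x s assume xs: "x \<in> \<Omega>" "0 < s" "s \<le> t" and neg: "0 < -1 * u x s + 0"
    have "\<bar>u x s\<bar> \<le> M" "\<bar>v x s\<bar> \<le> M" using M(2)[OF in_closure[OF xs(1)]] xs by auto
    then have "b1 * (- u x s) \<le> b1 * M" "c1 * (- v x s) \<le> c1 * M"
      using pos by - (rule mult_left_mono; linarith)+
    then have "a1 - b1 * u x s - c1 * v x s \<le> a1 + b1 * M + c1 * M" by linarith
    then have "(a1 - b1 * u x s - c1 * v x s) * (- u x s) \<le> (a1 + b1 * M + c1 * M) * (- u x s)"
      using neg by (intro mult_right_mono) auto
    then show "-1 * Ru x s + 0 \<le> (a1 + b1 * M + c1 * M) * (-1 * u x s + 0)"
      by (simp add: algebra_simps)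
  qed (use x t pos init_pos initial in auto)
  then show ?thesis by simp
qed

lemma growth_le:
  assumes x: "x \<in> closure \<Omega>" and t: "0 \<le> t"
  shows "a2 / (1 + k x * u x t) \<le> a2"
proof -
  have "1 \<le> 1 + k x * u x t" using k_nonneg[OF x] u_nonneg[OF x t] by simp
  then show ?thesis using pos by (simp add: divide_le_eq mult_le_cancel_left1)
qed

lemma v_nonneg:
  assumes x: "x \<in> closure \<Omega>" and t: "0 \<le> t"
  shows "0 \<le> v x t"
proof -
  obtain M where M: "0 \<le> M"
    "\<And>x s. x \<in> closure \<Omega> \<Longrightarrow> 0 \<le> s \<Longrightarrow> s \<le> t \<Longrightarrow> \<bar>u x s\<bar> \<le> M \<and> \<bar>v x s\<bar> \<le> M"
    using bounded_on_finite_time by blast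
  have "-1 * v x t + 0 \<le> 0"
  proof (rule scalar_comparison[where \<phi>' = "\<lambda>_. 0" and \<phi> = "\<lambda>_. 0" and T = t and L = "a2 + b2 * M + c2 * M",
        OF dom normal _ v_regular v_evol])
    fix x s assume xs: "x \<in> \<Omega>" "0 < s" "s \<le> t" and neg: "0 < -1 * v x s + 0"
    have "\<bar>u x s\<bar> \<le> M" "\<bar>v x s\<bar> \<le> M" using M(2)[OF in_closure[OF xs(1)]] xs by auto
    then have "b2 * (- v x s) \<le> b2 * M" "c2 * (- u x s) \<le> c2 * M"
      using pos by - (rule mult_left_mono; linarith)+
    then have "a2 / (1 + k x * u x s) - b2 * v x s - c2 * u x s \<le> a2 + b2 * M + c2 * M"
      using growth_le[OF in_closure[OF xs(1)], of s] xs by linarith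
    then have "(a2 / (1 + k x * u x s) - b2 * v x s - c2 * u x s) * (- v x s) \<le> (a2 + b2 * M + c2 * M) * (- v x s)"
      using neg by (intro mult_right_mono) auto
    then show "-1 * Rv x s + 0 \<le> (a2 + b2 * M + c2 * M) * (-1 * v x s + 0)"
      by (simp add: algebra_simps)
  qed (use x t pos init_pos initial in auto)
  then show ?thesis by simp
qed

lemma u_upper:
  assumes x: "x \<in> closure \<Omega>" and t: "0 \<le> t"
  shows "u x t \<le> a1 / b1 + c * exp (- (a1 * t))"
proof (rule logistic_upper_bound[OF dom normal _ u_regular u_evol _ _ _ _ _ x t])
  fix x s assume xs: "x \<in> \<Omega>" "0 < (s::real)"
  show "Ru x s \<le> u x s * (a1 - b1 * u x s)"
    using u_nonneg[of x s] v_nonneg[of x s] in_closure xs pos by (intro mult_left_mono) auto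
qed (use pos init_pos initial in auto)

lemma v_upper:
  assumes x: "x \<in> closure \<Omega>" and t: "0 \<le> t"
  shows "v x t \<le> a2 / b2 + d * exp (- (a2 * t))"
proof (rule logistic_upper_bound[OF dom normal _ v_regular v_evol _ _ _ _ _ x t])
  fix x s assume xs: "x \<in> \<Omega>" "0 < (s::real)"
  have "0 \<le> c2 * u x s" using u_nonneg[of x s] in_closure xs pos by simp
  then show "Rv x s \<le> v x s * (a2 - b2 * v x s)"
    using v_nonneg[of x s] growth_le[of x s] in_closure xs by (intro mult_left_mono) auto
qed (use pos init_pos initial in auto)

lemma u_bounded_below:
  assumes T: "0 \<le> T"
  obtains \<mu> where "0 < \<mu>" "\<And>x. x \<in> closure \<Omega> \<Longrightarrow> \<mu> \<le> u x T"
proof -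
  obtain M where M: "0 \<le> M"
    "\<And>x s. x \<in> closure \<Omega> \<Longrightarrow> 0 \<le> s \<Longrightarrow> s \<le> T \<Longrightarrow> \<bar>u x s\<bar> \<le> M \<and> \<bar>v x s\<bar> \<le> M"
    using bounded_on_finite_time by blast
  define l where "l = b1 * M + c1 * M"
  have "-1 * u x T + c * exp (- (l * T)) \<le> 0" if x: "x \<in> closure \<Omega>" for x
  proof (rule scalar_comparison[where \<phi>' = "\<lambda>t. - l * (c * exp (- (l * t)))" and T = T and L = "- l",
        OF dom normal _ u_regular u_evol])
    show "((\<lambda>t. c * exp (- (l * t))) has_real_derivative - l * (c * exp (- (l * t)))) (at t)" for t
      by (auto intro!: derivative_eq_intros)
    fix x s assume xs: "x \<in> \<Omega>" "0 < s" "s \<le> T"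
    have "\<bar>u x s\<bar> \<le> M" "\<bar>v x s\<bar> \<le> M" using M(2)[OF in_closure[OF xs(1)]] xs by auto
    then have "b1 * u x s \<le> b1 * M" "c1 * v x s \<le> c1 * M"
      using pos by - (rule mult_left_mono; linarith)+
    then have "- l \<le> a1 - b1 * u x s - c1 * v x s" unfolding l_def using pos by linarith
    then have "u x s * (- l) \<le> Ru x s"
      using u_nonneg[OF in_closure[OF xs(1)], of s] xs by (intro mult_left_mono) auto
    then show "-1 * Ru x s + - l * (c * exp (- (l * s))) \<le> - l * (-1 * u x s + c * exp (- (l * s)))"
      by (simp add: algebra_simps)
  qed (use x T pos initial in auto)
  then show thesis using init_pos by (intro that[of "c * exp (- (l * T))"]) auto
qed

lemma moving_rectangle:
  assumes T0: "0 \<le> T0" and \<phi>: "0 < \<phi>0" "\<phi>0 \<le> \<phi>1" and \<psi>: "0 < \<psi>1" "\<psi>1 \<le> \<psi>0" and \<kappa>: "0 < \<kappa>"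
    and s0: "b1 * \<phi>0 + c1 * \<psi>0 \<le> a1 - \<kappa>" "a2 + \<kappa> \<le> b2 * \<psi>0 + c2 * \<phi>0"
    and s1: "b1 * \<phi>1 + c1 * \<psi>1 \<le> a1 - \<kappa>" "a2 + \<kappa> \<le> b2 * \<psi>1 + c2 * \<phi>1"
    and start: "\<And>x. x \<in> closure \<Omega> \<Longrightarrow> \<phi>0 \<le> u x T0" "\<And>x. x \<in> closure \<Omega> \<Longrightarrow> v x T0 \<le> \<psi>0"
  obtains \<sigma> where "0 < \<sigma>"
    "\<And>x t. x \<in> closure \<Omega> \<Longrightarrow> T0 \<le> t \<Longrightarrow> \<phi>1 - (\<phi>1 - \<phi>0) * exp (- (\<sigma> * (t - T0))) \<le> u x t"
    "\<And>x t. x \<in> closure \<Omega> \<Longrightarrow> T0 \<le> t \<Longrightarrow> v x t \<le> \<psi>1 + (\<psi>0 - \<psi>1) * exp (- (\<sigma> * (t - T0)))"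
proof -
  define \<sigma> where "\<sigma> = min (\<kappa> * \<phi>0 / \<phi>1) (\<kappa> * \<psi>1 / \<psi>0)"
  have \<sigma>: "0 < \<sigma>" using \<phi> \<psi> \<kappa> by (simp add: \<sigma>_def)
  have "\<sigma> \<le> \<kappa> * \<phi>0 / \<phi>1" "\<sigma> \<le> \<kappa> * \<psi>1 / \<psi>0" "0 < \<phi>1" "0 < \<psi>0"
    using \<phi> \<psi> by (auto simp: \<sigma>_def)
  then have \<sigma>le: "\<sigma> * \<phi>1 \<le> \<kappa> * \<phi>0" "\<sigma> * \<psi>0 \<le> \<kappa> * \<psi>1" by (auto simp: pos_le_divide_eq)
  define e where "e t = exp (- (\<sigma> * (t - T0)))" for t
  have e: "0 < e t" "T0 \<le> t \<Longrightarrow> e t \<le> 1" for t using \<sigma> by (auto simp: e_def)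
  have de: "(e has_real_derivative - \<sigma> * e t) (at t)" for t
    unfolding e_def by (auto intro!: derivative_eq_intros)
  define p where "p t = \<phi>1 - (\<phi>1 - \<phi>0) * e t" for t
  define q where "q t = \<psi>1 + (\<psi>0 - \<psi>1) * e t" for t
  define p' where "p' t = \<sigma> * (\<phi>1 - \<phi>0) * e t" for t
  define q' where "q' t = \<sigma> * (\<psi>0 - \<psi>1) * e t" for t
  have dp: "(p has_real_derivative p' t) (at t)" and dq: "((\<lambda>t. - q t) has_real_derivative q' t) (at t)" for t
    unfolding p_def q_def p'_def q'_def by (auto intro!: derivative_eq_intros de)
  have path: "\<phi>0 \<le> p t \<and> p t \<le> \<phi>1 \<and> \<psi>1 \<le> q t \<and> p' t \<le> \<kappa> * p t \<and> q' t \<le> \<kappa> * q t \<and>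
      b1 * p t + c1 * q t \<le> a1 - \<kappa> \<and> a2 + \<kappa> \<le> b2 * q t + c2 * p t" if t: "T0 \<le> t" for t
  proof -
    note et = e(1)[of t] e(2)[OF t]
    have "(\<phi>1 - \<phi>0) * e t \<le> (\<phi>1 - \<phi>0) * 1" using \<phi> et by (intro mult_left_mono) auto
    then have 1: "\<phi>0 \<le> p t" by (simp add: p_def)
    have 2: "p t \<le> \<phi>1" using \<phi> et by (simp add: p_def)
    have 3: "\<psi>1 \<le> q t" using \<psi> et by (simp add: q_def)
    have "p' t \<le> (\<sigma> * \<phi>1) * 1" unfolding p'_def using \<phi> \<sigma> et by (intro mult_mono mult_left_mono) auto
    also have "\<dots> \<le> \<kappa> * p t" using \<sigma>le(1) mult_left_mono[OF 1, of \<kappa>] \<kappa> by linarith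
    finally have 4: "p' t \<le> \<kappa> * p t" .
    have "q' t \<le> (\<sigma> * \<psi>0) * 1" unfolding q'_def using \<psi> \<sigma> et by (intro mult_mono mult_left_mono) auto
    also have "\<dots> \<le> \<kappa> * q t" using \<sigma>le(2) mult_left_mono[OF 3, of \<kappa>] \<kappa> by linarith
    finally have 5: "q' t \<le> \<kappa> * q t" .
    have "b1 * p t + c1 * q t = e t * (b1 * \<phi>0 + c1 * \<psi>0) + (1 - e t) * (b1 * \<phi>1 + c1 * \<psi>1)"
      by (simp add: p_def q_def algebra_simps)
    also have "\<dots> \<le> e t * (a1 - \<kappa>) + (1 - e t) * (a1 - \<kappa>)"
      using s0 s1 et by (intro add_mono mult_left_mono) auto
    finally have 6: "b1 * p t + c1 * q t \<le> a1 - \<kappa>" by (simp add: algebra_simps)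
    have "e t * (a2 + \<kappa>) + (1 - e t) * (a2 + \<kappa>) \<le> e t * (b2 * \<psi>0 + c2 * \<phi>0) + (1 - e t) * (b2 * \<psi>1 + c2 * \<phi>1)"
      using add_mono[OF mult_left_mono[OF s0(2)] mult_left_mono[OF s1(2)]] et by simp
    also have "\<dots> = b2 * q t + c2 * p t" by (simp add: p_def q_def algebra_simps)
    finally have 7: "a2 + \<kappa> \<le> b2 * q t + c2 * p t" by (simp add: algebra_simps)
    show ?thesis using 1 2 3 4 5 6 7 by simp
  qed
  define M where "M = a2 / b2 + d"
  have vM: "v x t \<le> M" if "x \<in> closure \<Omega>" "0 \<le> t" for x t
  proof -
    have "d * exp (- (a2 * t)) \<le> d * 1" using init_pos pos that by (intro mult_left_mono) auto
    then show ?thesis using v_upper[OF that] by (simp add: M_def)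
  qed
  have M0: "0 \<le> M" using pos init_pos by (simp add: M_def)
  define L where "L = \<kappa> + c1 * \<phi>1 + c2 * M"
  have L: "\<kappa> + c1 * \<phi>1 \<le> L" "c2 * M \<le> L" using pos \<phi> M0 \<kappa> by (auto simp: L_def)
  let ?z = "\<lambda>i. if i then u else v" and ?\<sigma> = "\<lambda>i. if i then -1 else 1 :: real"
    and ?\<phi> = "\<lambda>i t. if i then p t else - q t"
  have main: "?\<sigma> i * ?z i x t + ?\<phi> i t \<le> 0" if x: "x \<in> closure \<Omega>" and t: "T0 \<le> t" for i x t
  proof (rule reaction_diffusion_comparison[where I = UNIV and z = ?z and \<sigma> = ?\<sigma> and \<phi> = ?\<phi> and T = t
        and D = "\<lambda>i. if i then d1 else d2" and R = "\<lambda>i. if i then Ru else Rv" and L = L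
        and \<phi>' = "\<lambda>i t. if i then p' t else q' t", OF dom normal _ _ T0 _ _ _ _ _ _ x t], goal_cases)
    case (6 i x t)
    have xc: "x \<in> closure \<Omega>" and t: "0 \<le> t" "T0 \<le> t" using 6 T0 in_closure by auto
    note P = path[OF t(2)] and u0 = u_nonneg[OF xc t(1)] and v0 = v_nonneg[OF xc t(1)]
    show ?case
    proof (cases i)
      case True
      define w where "w = p t - u x t"
      have w: "0 < w" "v x t - q t \<le> w" using 6 True by (auto simp: w_def dest: spec[of _ False])
      have "b1 * u x t \<le> b1 * p t" "c1 * v x t \<le> c1 * (q t + w)"
        using pos w by (auto intro!: mult_left_mono simp: w_def)
      then have "\<kappa> - c1 * w \<le> a1 - b1 * u x t - c1 * v x t" using P by (simp add: algebra_simps)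
      then have "u x t * (\<kappa> - c1 * w) \<le> Ru x t" using u0 by (intro mult_left_mono)
      moreover have "u x t * (c1 * w) \<le> \<phi>1 * (c1 * w)"
        using w pos P by (intro mult_right_mono) (auto simp: w_def)
      moreover have "u x t * (\<kappa> - c1 * w) = \<kappa> * p t - \<kappa> * w - u x t * (c1 * w)"
        by (simp add: w_def algebra_simps)
      moreover have "(\<kappa> + c1 * \<phi>1) * w \<le> L * w" using L w by (intro mult_right_mono) auto
      ultimately have "- Ru x t + p' t \<le> L * w" using P by (simp add: algebra_simps)
      then show ?thesis using True by (simp add: w_def)
    next
      case False
      define w where "w = v x t - q t"
      have w: "0 < w" "p t - u x t \<le> w" using 6 False by (auto simp: w_def dest: spec[of _ True])
      have "b2 * q t \<le> b2 * v x t" "c2 * (p t - w) \<le> c2 * u x t"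
        using pos w by (auto intro!: mult_left_mono simp: w_def)
      then have "a2 / (1 + k x * u x t) - b2 * v x t - c2 * u x t \<le> - \<kappa> + c2 * w"
        using P growth_le[OF xc t(1)] by (simp add: algebra_simps)
      then have "Rv x t \<le> v x t * (- \<kappa> + c2 * w)" using v0 by (intro mult_left_mono)
      moreover have "v x t * (c2 * w) \<le> M * (c2 * w)"
        using w pos vM[OF xc t(1)] by (intro mult_right_mono) auto
      moreover have "(c2 * M) * w \<le> L * w" using L w by (intro mult_right_mono) auto
      moreover have "\<kappa> * q t \<le> \<kappa> * v x t" using \<kappa> w by (intro mult_left_mono) (auto simp: w_def)
      ultimately have "Rv x t + q' t \<le> L * w" using P by (simp add: algebra_simps)
      then show ?thesis using False by (simp add: w_def)
    qed
  next
    case (7 i x)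
    then show ?case using start by (simp add: p_def q_def e_def)
  qed (use pos u_regular v_regular u_evol v_evol dp dq in auto)
  show thesis
  proof (rule that[OF \<sigma>])
    fix x t assume "x \<in> closure \<Omega>" "T0 \<le> t"
    then show "\<phi>1 - (\<phi>1 - \<phi>0) * exp (- (\<sigma> * (t - T0))) \<le> u x t"
      and "v x t \<le> \<psi>1 + (\<psi>0 - \<psi>1) * exp (- (\<sigma> * (t - T0)))"
      using main[of x t True] main[of x t False] by (auto simp: p_def q_def e_def)
  qed
qed

lemma exclusion:
  assumes c1: "a2 / c2 < a1 / b1" and c2: "a2 / b2 < a1 / c1" and \<epsilon>: "0 < \<epsilon>"
  shows "\<exists>T. \<forall>t\<ge>T. \<forall>x\<in>\<Omega>. \<bar>u x t - a1 / b1\<bar> < \<epsilon> \<and> \<bar>v x t\<bar> < \<epsilon>"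
proof -
  obtain \<psi>0 where \<psi>0: "a2 / b2 < \<psi>0" "\<psi>0 < a1 / c1" using dense[OF c2] by blast
  obtain m where m: "a2 / c2 < m" "m < a1 / b1" using dense[OF c1] by blast
  define \<phi>1 where "\<phi>1 = max m (a1 / b1 - \<epsilon> / 2)"
  have \<phi>1: "a2 / c2 < \<phi>1" "\<phi>1 < a1 / b1" "a1 / b1 - \<epsilon> / 2 \<le> \<phi>1"
    using m \<epsilon> by (auto simp: \<phi>1_def)
  have gap1: "0 < a1 - b1 * \<phi>1" using \<phi>1(2) pos by (simp add: field_simps)
  define \<psi>1 where "\<psi>1 = min (min (\<epsilon> / 2) ((a1 - b1 * \<phi>1) / (2 * c1))) (a2 / b2)"
  have "\<psi>1 \<le> \<epsilon> / 2" "\<psi>1 \<le> (a1 - b1 * \<phi>1) / (2 * c1)" "\<psi>1 \<le> a2 / b2"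
    unfolding \<psi>1_def by linarith+
  moreover have "0 < \<psi>1" using gap1 \<epsilon> pos by (simp add: \<psi>1_def)
  ultimately have \<psi>1: "0 < \<psi>1" "\<psi>1 \<le> \<epsilon> / 2" "\<psi>1 \<le> \<psi>0" "\<psi>1 \<le> (a1 - b1 * \<phi>1) / (2 * c1)"
    using \<psi>0 by linarith+
  have \<phi>1p: "0 < \<phi>1" using \<phi>1(1) pos by (meson divide_pos_pos less_trans)
  obtain T0 where T0: "0 \<le> T0" "d * exp (- (a2 * T0)) < \<psi>0 - a2 / b2"
  proof -
    have "\<forall>\<^sub>F t in at_top. 0 \<le> t \<and> d * exp (- (a2 * (t - 0))) < \<psi>0 - a2 / b2"
      using \<psi>0 pos by (intro eventually_conj eventually_ge_at_top eventually_exp_decay) auto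
    then show thesis using that by (auto dest: eventually_happens)
  qed
  obtain \<mu> where \<mu>: "0 < \<mu>" "\<And>x. x \<in> closure \<Omega> \<Longrightarrow> \<mu> \<le> u x T0"
    using u_bounded_below[OF T0(1)] by blast
  define \<phi>0 where "\<phi>0 = min (min \<mu> \<phi>1) ((a1 - c1 * \<psi>0) / (2 * b1))"
  have gap: "0 < a1 - c1 * \<psi>0" using \<psi>0 pos by (simp add: field_simps)
  have \<phi>0: "0 < \<phi>0" "\<phi>0 \<le> \<mu>" "\<phi>0 \<le> \<phi>1" "\<phi>0 \<le> (a1 - c1 * \<psi>0) / (2 * b1)"
    using gap \<mu> \<phi>1p pos by (auto simp: \<phi>0_def)
  have g1: "b1 * \<phi>0 + c1 * \<psi>0 < a1"
    using \<phi>0(4) gap pos by (simp add: field_simps)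
  have g2: "a2 < b2 * \<psi>0 + c2 * \<phi>0"
    using \<psi>0(1) pos mult_pos_pos[OF pos(8) \<phi>0(1)] by (simp add: field_simps)
  have g3: "b1 * \<phi>1 + c1 * \<psi>1 < a1"
    using \<psi>1(4) gap1 pos by (simp add: field_simps)
  have g4: "a2 < b2 * \<psi>1 + c2 * \<phi>1"
    using \<phi>1(1) pos mult_pos_pos[OF pos(6) \<psi>1(1)] by (simp add: field_simps)
  define \<kappa> where "\<kappa> = min (min (a1 - (b1 * \<phi>0 + c1 * \<psi>0)) (b2 * \<psi>0 + c2 * \<phi>0 - a2))
    (min (a1 - (b1 * \<phi>1 + c1 * \<psi>1)) (b2 * \<psi>1 + c2 * \<phi>1 - a2))"
  have \<kappa>: "0 < \<kappa>" "b1 * \<phi>0 + c1 * \<psi>0 \<le> a1 - \<kappa>" "a2 + \<kappa> \<le> b2 * \<psi>0 + c2 * \<phi>0"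
    "b1 * \<phi>1 + c1 * \<psi>1 \<le> a1 - \<kappa>" "a2 + \<kappa> \<le> b2 * \<psi>1 + c2 * \<phi>1"
    using g1 g2 g3 g4 unfolding \<kappa>_def by linarith+
  have start: "\<phi>0 \<le> u x T0" "v x T0 \<le> \<psi>0" if "x \<in> closure \<Omega>" for x
    using \<mu>(2)[OF that] \<phi>0(2) v_upper[OF that T0(1)] T0(2) by auto
  obtain \<sigma> where \<sigma>: "0 < \<sigma>"
    "\<And>x t. x \<in> closure \<Omega> \<Longrightarrow> T0 \<le> t \<Longrightarrow> \<phi>1 - (\<phi>1 - \<phi>0) * exp (- (\<sigma> * (t - T0))) \<le> u x t"
    "\<And>x t. x \<in> closure \<Omega> \<Longrightarrow> T0 \<le> t \<Longrightarrow> v x t \<le> \<psi>1 + (\<psi>0 - \<psi>1) * exp (- (\<sigma> * (t - T0)))"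
    using moving_rectangle[OF T0(1) \<phi>0(1,3) \<psi>1(1,3) \<kappa> start] by blast
  have "\<forall>\<^sub>F t in at_top. T0 \<le> t \<and> (\<phi>1 - \<phi>0) * exp (- (\<sigma> * (t - T0))) < \<epsilon> / 2 \<and>
      (\<psi>0 - \<psi>1) * exp (- (\<sigma> * (t - T0))) < \<epsilon> / 2 \<and> c * exp (- (a1 * (t - 0))) < \<epsilon>"
    using \<epsilon> \<sigma>(1) pos by (intro eventually_conj eventually_ge_at_top eventually_exp_decay) auto
  then obtain T where T: "\<And>t. T \<le> t \<Longrightarrow> T0 \<le> t \<and> (\<phi>1 - \<phi>0) * exp (- (\<sigma> * (t - T0))) < \<epsilon> / 2 \<and>
      (\<psi>0 - \<psi>1) * exp (- (\<sigma> * (t - T0))) < \<epsilon> / 2 \<and> c * exp (- (a1 * (t - 0))) < \<epsilon>"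
    unfolding eventually_at_top_linorder by blast
  show ?thesis
  proof (intro exI[of _ T] allI impI ballI)
    fix t x assume t: "T \<le> t" and "x \<in> \<Omega>"
    then have x: "x \<in> closure \<Omega>" by (simp add: in_closure)
    have t0: "T0 \<le> t" "0 \<le> t" using T[OF t] T0(1) by auto
    have "- \<epsilon> < u x t - a1 / b1"
      using \<sigma>(2)[OF x t0(1)] T[OF t] \<phi>1(3) by linarith
    moreover have "u x t - a1 / b1 < \<epsilon>" using u_upper[OF x t0(2)] T[OF t] by simp
    moreover have "v x t < \<epsilon>" using \<sigma>(3)[OF x t0(1)] T[OF t] \<psi>1(2) by linarith
    ultimately show "\<bar>u x t - a1 / b1\<bar> < \<epsilon> \<and> \<bar>v x t\<bar> < \<epsilon>"
      using v_nonneg[OF x t0(2)] by auto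
  qed
qed

end

theorem mainTheorem16:
  fixes \<Omega> :: "(real^'n) set" and \<nu> :: "real^'n \<Rightarrow> real^'n" and k :: "real^'n \<Rightarrow> real"
    and u v :: "real^'n \<Rightarrow> real \<Rightarrow> real"
    and d1 d2 a1 a2 b1 b2 c1 c2 c d :: real
  assumes dom: "open \<Omega>" "connected \<Omega>" "bounded \<Omega>" "\<Omega> \<noteq> {}"
    and normal: "outward_unit_normal \<Omega> \<nu>"
    and k_C1: "C1_closure \<Omega> k"
    and k_nonneg: "\<forall>x\<in>closure \<Omega>. k x \<ge> 0"
    and k_zeros: "{x\<in>closure \<Omega>. k x = 0} \<in> null_sets lebesgue"
    and pos: "d1 > 0" "d2 > 0" "a1 > 0" "a2 > 0" "b1 > 0" "b2 > 0" "c1 > 0" "c2 > 0"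
    and init_pos: "c > 0" "d > 0"
    and sol: "classical_solution \<Omega> \<nu> k d1 d2 a1 a2 b1 b2 c1 c2 c d u v"
    and cond: "a1 / a2 > max (b1 / c2) (c1 / b2)"
  shows "\<forall>\<epsilon>>0. \<exists>T. \<forall>t\<ge>T. \<forall>x\<in>\<Omega>. \<bar>u x t - a1 / b1\<bar> < \<epsilon> \<and> \<bar>v x t\<bar> < \<epsilon>"
proof -
  interpret competition \<Omega> \<nu> k u v d1 d2 a1 a2 b1 b2 c1 c2 c d
    using assms by unfold_locales auto
  have "a2 / c2 < a1 / b1" "a2 / b2 < a1 / c1" using cond pos by (auto simp: field_simps)
  then show ?thesis using exclusion by blast
qed

end
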